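(* Let $G$ be a finite complete multipartite graph and let $H$ be an arbitrary finite simple graph. Then $$\pi(H)+(\pi(G)-1)\,|V(H)|=\pi(G\circ H)=\pi(H)+\bigl(|V(G)|-\alpha(G)\bigr)\,|V(H)|,$$ where $G\circ H$ is the lexicographic product, $\pi$ is the Thue chromatic number and $\alpha(G)$ is the independence number of $G$.
   Context: A repetition is a sequence $r_1\ldots r_{2n}$ with $n\ge 1$ and $r_i=r_{n+i}$ for all $1\le i\le n$. A vertex colouring $\varphi$ of a simple graph $G$ is non-repetitive if for every $n\ge 1$ and every simple path (distinct vertices, consecutive ones adjacent) $v_1\ldots v_{2n}$ in $G$, the colour sequence $\varphi(v_1)\ldots\varphi(v_{2n})$ is not a repetition (the case $n=1$ says that $\varphi$ is a proper colouring). The Thue chromatic number $\pi(G)$ is the minimum number of colours in a non-repetitive colouring of $G$. The lexicographic product $G\circ H$ has vertex set $V(G)\times V(H)$, and $(u,v)$ and $(x,y)$ are adjacent iff either $u$ is adjacent to $x$ in $G$, or $u=x$ and $v$ is adjacent to $y$ in $H$. A complete multipartite graph $K_{n_1,\ldots,n_k}$ ($k\ge 1$, all $n_i\ge 1$) has vertex set partitioned into sets $V_1,\ldots,V_k$ with $|V_i|=n_i$, two vertices being adjacent iff they lie in different partite sets. *)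

theory Defs
  imports "Graph_Theory.Graph_Theory" "HOL-Library.Disjoint_Sets"
begin

text \<open>
  A finite simple graph is a \<open>pair_graph\<close>: a finite vertex set together with a symmetric,
  irreflexive set of ordered pairs of vertices, an edge being represented by its two orientations.
  Isolated vertices, and the graph without vertices, are allowed.
\<close>

definition repetition :: "'c list \<Rightarrow> bool" where
  "repetition r \<longleftrightarrow> (\<exists>n\<ge>1. length r = 2 * n \<and> (\<forall>i<n. r ! i = r ! (n + i)))"

definition nonrepetitive_colouring :: "'a pair_pre_digraph \<Rightarrow> ('a \<Rightarrow> 'c) \<Rightarrow> bool" where
  "nonrepetitive_colouring G \<phi> \<longleftrightarrow> (\<forall>p. vpath p (with_proj G) \<longrightarrow> \<not> repetition (map \<phi> p))"

text \<open>
  Only colours that actually occur on a vertex are counted. Natural numbers as colours are no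
  restriction on a finite graph, and the injective colourings are non-repetitive, so the minimum
  exists.
\<close>

definition thue_chromatic_number :: "'a pair_pre_digraph \<Rightarrow> nat" where
  "thue_chromatic_number G =
    (LEAST k. \<exists>\<phi> :: 'a \<Rightarrow> nat. nonrepetitive_colouring G \<phi> \<and> card (\<phi> ` pverts G) = k)"

definition lex_product ::
  "'a pair_pre_digraph \<Rightarrow> 'b pair_pre_digraph \<Rightarrow> ('a \<times> 'b) pair_pre_digraph" where
  "lex_product G H =
    \<lparr> pverts = pverts G \<times> pverts H,
      parcs = {((u, v), (x, y)). (u, v) \<in> pverts G \<times> pverts H \<and> (x, y) \<in> pverts G \<times> pverts H \<and>
                 ((u, x) \<in> parcs G \<or> u = x \<and> (v, y) \<in> parcs H)} \<rparr>"

lemma pair_graph_lex_product: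
  assumes "pair_graph G" "pair_graph H"
  shows "pair_graph (lex_product G H)"
proof -
  interpret G: pair_graph G by fact
  interpret H: pair_graph H by fact
  let ?L = "lex_product G H"
  have fin: "finite (pverts ?L)"
    by (simp add: lex_product_def G.pair_finite_verts H.pair_finite_verts)
  have sub: "parcs ?L \<subseteq> pverts ?L \<times> pverts ?L"
    by (auto simp: lex_product_def)
  have sym: "symmetric (with_proj ?L)"
    by (auto simp: symmetric_def lex_product_def intro!: symI
        dest: G.arcs_symmetric H.arcs_symmetric)
  have irr: "fst e \<noteq> snd e" if "e \<in> parcs ?L" for e
    using that by (auto simp: lex_product_def dest: G.no_loops' H.no_loops')
  show ?thesis
    using fin sub sym irr finite_subset[OF sub] by unfold_locales auto
qed

text \<open>
  The partite sets are the members of the partition \<open>P\<close>; \<open>partition_on\<close> makes them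
  non-empty, and \<open>P \<noteq> {}\<close> says that there is at least one of them. A single partite set,
  giving an edgeless graph, is allowed.
\<close>

definition complete_multipartite :: "'a pair_pre_digraph \<Rightarrow> bool" where
  "complete_multipartite G \<longleftrightarrow> pair_graph G \<and>
    (\<exists>P. partition_on (pverts G) P \<and> P \<noteq> {} \<and>
      parcs G = {(u, v). \<exists>X\<in>P. \<exists>Y\<in>P. X \<noteq> Y \<and> u \<in> X \<and> v \<in> Y})"

definition independent_set :: "'a pair_pre_digraph \<Rightarrow> 'a set \<Rightarrow> bool" where
  "independent_set G S \<longleftrightarrow> S \<subseteq> pverts G \<and> (\<forall>u\<in>S. \<forall>v\<in>S. (u, v) \<notin> parcs G)"

definition independence_number :: "'a pair_pre_digraph \<Rightarrow> nat" where
  "independence_number G = Max {card S | S. independent_set G S}"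

end

theory Submission
  imports Defs
begin

text \<open>
  Upper bound: for an independent set \<open>S\<close> of \<open>G\<close>, reuse one colouring of \<open>H\<close> on all copies of
  \<open>H\<close> over \<open>S\<close> and give every other vertex a private colour; a path avoiding the private colours
  stays inside one copy. Lower bound: different partite sets receive disjoint colour sets, and if
  two of them both carried a repeated colour, the four vertices would form a repetitive path
  \<open>a b a' b'\<close>. Hence the colouring is injective outside the copies over a single partite
  set, and one of those copies already needs \<open>\<pi>(H)\<close> colours. The value of \<open>\<pi>(G)\<close> itself is the
  case where \<open>H\<close> is a single vertex.
\<close>

section \<open>Repetitions and recurring colours\<close>

lemma repetition_map_inj:
  assumes "inj_on g (set xs)" "repetition (map g xs)"
  shows "repetition xs"
proof -
  from assms(2) obtain n where n: "n \<ge> 1" "length xs = 2 * n"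
    and eq: "\<And>i. i < n \<Longrightarrow> map g xs ! i = map g xs ! (n + i)"
    by (auto simp: repetition_def)
  have "xs ! i = xs ! (n + i)" if "i < n" for i
    using eq[OF that] n that by (intro inj_onD[OF assms(1)]) auto
  then show ?thesis
    using n by (auto simp: repetition_def)
qed

text \<open>Each position is matched with the one at distance \<open>n\<close>, which holds the same
  colour and, \<open>p\<close> being distinct, another vertex. So a vertex with a private colour
  lies on no repetitively coloured path.\<close>

lemma repetition_colour_occurs_twice:
  assumes "distinct p" "repetition (map \<phi> p)" "v \<in> set p"
  shows "\<exists>w\<in>set p. w \<noteq> v \<and> \<phi> w = \<phi> v"
proof -
  from assms(2) obtain n where n: "length p = 2 * n"
    and eq: "\<And>i. i < n \<Longrightarrow> map \<phi> p ! i = map \<phi> p ! (n + i)"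
    by (auto simp: repetition_def)
  from assms(3) obtain i where i: "i < length p" "v = p ! i"
    by (auto simp: in_set_conv_nth)
  define j where "j = (if i < n then n + i else i - n)"
  have j: "j < length p" "j \<noteq> i"
    using i(1) n by (auto simp: j_def)
  moreover have "\<phi> (p ! j) = \<phi> (p ! i)"
    using eq[of i] eq[of "i - n"] i(1) n by (auto simp: j_def)
  ultimately show ?thesis
    using assms(1) i by (intro bexI[of _ "p ! j"]) (auto simp: nth_eq_iff_index_eq)
qed

lemma finite_pverts: "pair_graph G \<Longrightarrow> finite (pverts G)"
  by (rule pair_fin_digraph.pair_finite_verts)
    (simp add: pair_graph_def pair_digraph_def)

lemma pair_wf_digraph_pair_graph: "pair_graph G \<Longrightarrow> pair_wf_digraph G"
  by (simp add: pair_graph_def pair_digraph_def pair_fin_digraph_def)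

lemma pair_graph_complete_multipartite: "complete_multipartite G \<Longrightarrow> pair_graph G"
  by (simp add: complete_multipartite_def)

section \<open>Transfer of paths and colourings\<close>

lemma vwalk_arcs_map: "vwalk_arcs (map f p) = map (map_prod f f) (vwalk_arcs p)"
  by (induction p rule: vwalk_arcs.induct) auto

lemma vpath_map:
  assumes "vpath p (with_proj G)" "inj_on f (pverts G)" "f ` pverts G \<subseteq> pverts G'"
    and "\<And>u v. (u, v) \<in> parcs G \<Longrightarrow> (f u, f v) \<in> parcs G'"
  shows "vpath (map f p) (with_proj G')"
proof -
  have p: "set p \<subseteq> pverts G" "set (vwalk_arcs p) \<subseteq> parcs G" "p \<noteq> []" "distinct p"
    using assms(1) by (auto simp: vpath_def vwalk_def)
  have "inj_on f (set p)"
    using assms(2) p(1) by (rule inj_on_subset)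
  moreover have "map_prod f f ` set (vwalk_arcs p) \<subseteq> parcs G'"
    using p(2) assms(4) by auto
  moreover have "f ` set p \<subseteq> pverts G'"
    using p(1) assms(3) by blast
  ultimately show ?thesis
    using p(3,4) by (simp add: vpath_def vwalk_def vwalk_arcs_map distinct_map)
qed

text \<open>An injection preserving arcs sends a path to a path with the same colour sequence, so a
  repetition in \<open>G\<close> would already occur in \<open>G'\<close>.\<close>

lemma nonrepetitive_colouring_comp:
  assumes "nonrepetitive_colouring G' \<phi>" "inj_on f (pverts G)" "f ` pverts G \<subseteq> pverts G'"
    and "\<And>u v. (u, v) \<in> parcs G \<Longrightarrow> (f u, f v) \<in> parcs G'"
  shows "nonrepetitive_colouring G (\<phi> \<circ> f)"
  unfolding nonrepetitive_colouring_def
proof (intro allI impI)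
  fix p assume "vpath p (with_proj G)"
  then have "vpath (map f p) (with_proj G')"
    using assms(2-4) by (rule vpath_map)
  then show "\<not> repetition (map (\<phi> \<circ> f) p)"
    using assms(1) by (auto simp: nonrepetitive_colouring_def)
qed

lemma nonrepetitive_colouring_recolour:
  assumes "nonrepetitive_colouring G \<phi>" "inj_on g (\<phi> ` pverts G)"
  shows "nonrepetitive_colouring G (g \<circ> \<phi>)"
  unfolding nonrepetitive_colouring_def
proof (intro allI impI notI)
  fix p assume p: "vpath p (with_proj G)" "repetition (map (g \<circ> \<phi>) p)"
  then have "inj_on g (set (map \<phi> p))"
    by (intro inj_on_subset[OF assms(2)]) (auto simp: vpath_def vwalk_def)
  with p have "repetition (map \<phi> p)"
    by (intro repetition_map_inj[of g]) auto
  with p assms(1) show False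
    by (auto simp: nonrepetitive_colouring_def)
qed

text \<open>\<open>thue_chromatic_number\<close> ranges over colourings by natural numbers; this
  admits other colour types as witnesses, such as the sum type of the upper bound.\<close>

lemma nonrepetitive_colouring_nat:
  fixes \<phi> :: "'a \<Rightarrow> 'c"
  assumes "finite (pverts G)" "nonrepetitive_colouring G \<phi>"
  shows "\<exists>\<psi> :: 'a \<Rightarrow> nat.
    nonrepetitive_colouring G \<psi> \<and> card (\<psi> ` pverts G) = card (\<phi> ` pverts G)"
proof -
  have "finite (\<phi> ` pverts G)"
    using assms(1) by simp
  then obtain g :: "'c \<Rightarrow> nat" where g: "inj_on g (\<phi> ` pverts G)"
    by (metis finite_imp_inj_to_nat_seg)
  then have "card ((g \<circ> \<phi>) ` pverts G) = card (\<phi> ` pverts G)"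
    by (metis card_image image_comp)
  then show ?thesis
    using nonrepetitive_colouring_recolour[OF assms(2) g] by blast
qed

section \<open>The Thue chromatic number as an attained minimum\<close>

lemma thue_chromatic_number_le:
  assumes "finite (pverts G)" "nonrepetitive_colouring G \<phi>"
  shows "thue_chromatic_number G \<le> card (\<phi> ` pverts G)"
  unfolding thue_chromatic_number_def
  by (rule Least_le) (rule nonrepetitive_colouring_nat[OF assms])

text \<open>Every colour is private, so none recurs on a path. This witness shows that the
  \<open>LEAST\<close> is attained.\<close>

lemma nonrepetitive_colouring_id: "nonrepetitive_colouring G id"
  unfolding nonrepetitive_colouring_def
proof (intro allI impI notI)
  fix p assume p: "vpath p (with_proj G)" "repetition (map id p)"
  then have "hd p \<in> set p" "distinct p"
    by (auto simp: vpath_def vwalk_def)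
  with p(2) show False
    using repetition_colour_occurs_twice[of p id "hd p"] by auto
qed

lemma thue_chromatic_number_attained:
  assumes "finite (pverts G)"
  obtains \<phi> :: "'a \<Rightarrow> nat" where
    "nonrepetitive_colouring (G :: 'a pair_pre_digraph) \<phi>"
    "card (\<phi> ` pverts G) = thue_chromatic_number G"
proof -
  have "\<exists>k. \<exists>\<phi> :: 'a \<Rightarrow> nat. nonrepetitive_colouring G \<phi> \<and> card (\<phi> ` pverts G) = k"
    using nonrepetitive_colouring_nat[OF assms nonrepetitive_colouring_id] by blast
  from LeastI_ex[OF this] show thesis
    using that unfolding thue_chromatic_number_def by blast
qed

text \<open>Counting only the colours on the image of \<open>f\<close> allows a single copy of
  \<open>H\<close> inside the product to be measured.\<close>

lemma thue_chromatic_number_le_embedding: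
  assumes "finite (pverts G)" "nonrepetitive_colouring G' \<phi>"
    and "inj_on f (pverts G)" "f ` pverts G \<subseteq> pverts G'"
    and "\<And>u v. (u, v) \<in> parcs G \<Longrightarrow> (f u, f v) \<in> parcs G'"
  shows "thue_chromatic_number G \<le> card (\<phi> ` f ` pverts G)"
  using thue_chromatic_number_le[OF assms(1) nonrepetitive_colouring_comp[OF assms(2-5)]]
  by (simp add: image_comp)

lemma thue_chromatic_number_mono:
  assumes "finite (pverts G)" "finite (pverts G')"
    and "inj_on f (pverts G)" "f ` pverts G \<subseteq> pverts G'"
    and "\<And>u v. (u, v) \<in> parcs G \<Longrightarrow> (f u, f v) \<in> parcs G'"
  shows "thue_chromatic_number G \<le> thue_chromatic_number G'"
proof -
  obtain \<phi> :: "_ \<Rightarrow> nat" where \<phi>: "nonrepetitive_colouring G' \<phi>"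
    "card (\<phi> ` pverts G') = thue_chromatic_number G'"
    using thue_chromatic_number_attained[OF assms(2)] .
  have "thue_chromatic_number G \<le> card (\<phi> ` f ` pverts G)"
    by (rule thue_chromatic_number_le_embedding[OF assms(1) \<phi>(1) assms(3-5)])
  also have "\<dots> \<le> card (\<phi> ` pverts G')"
    using assms(2,4) by (intro card_mono) auto
  finally show ?thesis
    using \<phi>(2) by simp
qed

section \<open>Upper bound for the lexicographic product\<close>

lemma lex_product_verts [simp]: "pverts (lex_product G H) = pverts G \<times> pverts H"
  by (simp add: lex_product_def)

text \<open>An arc of the product either projects to an arc of \<open>G\<close>, which cannot join
  two members of \<open>S\<close>, or stays in one copy and projects to an arc of
  \<open>H\<close>.\<close>

lemma lex_product_walk_over_independent_set:
  assumes "vwalk p (with_proj (lex_product G H))"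
    and "independent_set G S" "fst ` set p \<subseteq> S"
  shows "vwalk (map snd p) (with_proj H) \<and> (\<forall>x\<in>set p. fst x = fst (hd p))"
  using assms(1,3)
proof (induction p rule: vwalk_arcs.induct)
  case (3 x y xs)
  have arc: "(x, y) \<in> parcs (lex_product G H)"
    and tail: "vwalk (y # xs) (with_proj (lex_product G H))"
    using "3.prems"(1) by (simp_all add: vwalk_def)
  have "fst ` set (y # xs) \<subseteq> S"
    using "3.prems"(2) by simp
  from "3.IH"[OF tail this]
  have IH: "vwalk (map snd (y # xs)) (with_proj H)" "\<forall>z\<in>set (y # xs). fst z = fst y"
    by simp_all
  have "(fst x, fst y) \<notin> parcs G"
    using assms(2) "3.prems"(2) by (simp add: independent_set_def)
  then have eq: "fst x = fst y" and "(snd x, snd y) \<in> parcs H" "snd x \<in> pverts H"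
    using arc by (auto simp: lex_product_def)
  then have "vwalk (map snd (x # y # xs)) (with_proj H)"
    using IH(1) by (simp add: vwalk_def)
  moreover have "\<forall>z\<in>set (x # y # xs). fst z = fst x"
    unfolding eq using IH(2) eq by (metis set_ConsD)
  ultimately show ?case
    by simp
qed (auto simp: vwalk_def)

lemma thue_chromatic_number_lex_product_le:
  assumes "finite (pverts G)" "finite (pverts H)" and S: "independent_set G S"
  shows "thue_chromatic_number (lex_product G H)
    \<le> thue_chromatic_number H + (card (pverts G) - card S) * card (pverts H)"
proof -
  let ?V = "pverts G" and ?W = "pverts H" and ?L = "lex_product G H"
  have SV: "S \<subseteq> ?V"
    using S by (simp add: independent_set_def)
  obtain c :: "_ \<Rightarrow> nat" where c: "nonrepetitive_colouring H c"
    "card (c ` ?W) = thue_chromatic_number H"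
    using thue_chromatic_number_attained[OF assms(2)] .
  \<comment> \<open>\<open>Inl\<close> and \<open>Inr\<close> keep the shared and the private
    palette apart; a vertex outside the copies over \<open>S\<close> serves as its own
    colour.\<close>
  define \<phi> where "\<phi> x = (if fst x \<in> S then Inl (c (snd x)) else Inr x)" for x
  have "nonrepetitive_colouring ?L \<phi>"
    unfolding nonrepetitive_colouring_def
  proof (intro allI impI notI)
    fix p assume p: "vpath p (with_proj ?L)" "repetition (map \<phi> p)"
    then have walk: "vwalk p (with_proj ?L)" and dist: "distinct p"
      by (auto simp: vpath_def)
    \<comment> \<open>Each colour on \<open>p\<close> occurs at a second vertex, which excludes the
      private colours.\<close>
    have over_S: "fst ` set p \<subseteq> S"
    proof
      fix u assume "u \<in> fst ` set p"
      then obtain x where x: "x \<in> set p" "u = fst x"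
        by auto
      then obtain y where "y \<in> set p" "y \<noteq> x" "\<phi> y = \<phi> x"
        using repetition_colour_occurs_twice[OF dist p(2)] by blast
      then show "u \<in> S"
        using x by (auto simp: \<phi>_def split: if_splits)
    qed
    note copy = lex_product_walk_over_independent_set[OF walk S over_S]
    \<comment> \<open>The first coordinate is constant along \<open>p\<close>, so the projection to
      \<open>H\<close> keeps the vertices distinct.\<close>
    have "inj_on snd (set p)"
      using conjunct2[OF copy] by (metis inj_onI prod.expand)
    then have "vpath (map snd p) (with_proj H)"
      using conjunct1[OF copy] dist by (simp add: vpath_def distinct_map)
    moreover have colours: "map \<phi> p = map Inl (map c (map snd p))"
      using over_S by (auto simp: \<phi>_def)
    have "repetition (map c (map snd p))"
      using p(2) unfolding colours by (rule repetition_map_inj[OF inj_Inl])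
    ultimately show False
      using c(1) by (auto simp: nonrepetitive_colouring_def)
  qed
  then have "thue_chromatic_number ?L \<le> card (\<phi> ` (?V \<times> ?W))"
    using thue_chromatic_number_le[of ?L \<phi>] assms by simp
  also have "\<dots> \<le> card (c ` ?W <+> (?V - S) \<times> ?W)"
    using assms by (intro card_mono) (auto simp: \<phi>_def)
  also have "\<dots> = card (c ` ?W) + card ((?V - S) \<times> ?W)"
    using assms by (intro card_Plus) auto
  also have "\<dots> = thue_chromatic_number H + (card ?V - card S) * card ?W"
    using SV assms(1) c(2)
    by (simp add: card_cartesian_product card_Diff_subset finite_subset)
  finally show ?thesis .
qed

section \<open>The independence number as an attained maximum\<close>

lemma finite_independent_set_cards:
  assumes "finite (pverts G)"
  shows "finite {card S | S. independent_set G S}"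
proof (rule finite_subset)
  show "{card S | S. independent_set G S} \<subseteq> card ` Pow (pverts G)"
    by (auto simp: independent_set_def)
qed (use assms in simp)

lemma independence_number_attained:
  assumes "finite (pverts G)"
  shows "\<exists>S. independent_set G S \<and> card S = independence_number G"
proof -
  have "independent_set G {}"
    by (simp add: independent_set_def)
  then have "{card S | S. independent_set G S} \<noteq> {}"
    by blast
  with finite_independent_set_cards[OF assms]
  have "independence_number G \<in> {card S | S. independent_set G S}"
    unfolding independence_number_def by (rule Max_in)
  then show ?thesis
    by auto
qed

lemma card_le_independence_number:
  assumes "finite (pverts G)" "independent_set G S"
  shows "card S \<le> independence_number G"
  unfolding independence_number_def
  using finite_independent_set_cards[OF assms(1)] assms(2) by (intro Max_ge) auto

section \<open>Lower bound for complete multipartite graphs\<close>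

lemma nonrepetitive_colouring_adjacent:
  assumes "nonrepetitive_colouring G \<phi>" "(a, b) \<in> parcs G" "a \<in> pverts G" "b \<in> pverts G" "a \<noteq> b"
  shows "\<phi> a \<noteq> \<phi> b"
proof
  assume "\<phi> a = \<phi> b"
  then have "repetition (map \<phi> [a, b])"
    by (auto simp: repetition_def intro!: exI[of _ 1])
  moreover have "vpath [a, b] (with_proj G)"
    using assms by (auto simp: vpath_def vwalk_def)
  ultimately show False
    using assms(1) by (auto simp: nonrepetitive_colouring_def)
qed

text \<open>Equality would colour the path \<open>a b a' b'\<close> in the pattern
  \<open>xyxy\<close>, a repetition with \<open>n = 2\<close>.\<close>

lemma nonrepetitive_colouring_two_pairs:
  assumes "nonrepetitive_colouring G \<phi>" "{a, a', b, b'} \<subseteq> pverts G" "distinct [a, b, a', b']"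
    and "{(a, b), (b, a'), (a', b')} \<subseteq> parcs G" "\<phi> a = \<phi> a'"
  shows "\<phi> b \<noteq> \<phi> b'"
proof
  assume "\<phi> b = \<phi> b'"
  with assms(5) have "repetition (map \<phi> [a, b, a', b'])"
    by (auto simp: repetition_def less_Suc_eq numeral_2_eq_2 intro!: exI[of _ 2])
  moreover have "vpath [a, b, a', b'] (with_proj G)"
    using assms(2-4) by (auto simp: vpath_def vwalk_def)
  ultimately show False
    using assms(1) by (auto simp: nonrepetitive_colouring_def)
qed

lemma thue_chromatic_number_lex_product_ge:
  assumes G: "complete_multipartite G" and H: "pair_graph H"
  shows "thue_chromatic_number (lex_product G H)
    \<ge> thue_chromatic_number H + (card (pverts G) - independence_number G) * card (pverts H)"
proof -
  let ?V = "pverts G" and ?W = "pverts H" and ?L = "lex_product G H"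
  from G obtain P where "pair_graph G" and P: "partition_on ?V P" "P \<noteq> {}"
    and arcs: "parcs G = {(u, v). \<exists>X\<in>P. \<exists>Y\<in>P. X \<noteq> Y \<and> u \<in> X \<and> v \<in> Y}"
    by (auto simp: complete_multipartite_def)
  have fin: "finite ?V" "finite ?W"
    using \<open>pair_graph G\<close> H by (simp_all add: finite_pverts)
  have part_subset: "X \<subseteq> ?V" if "X \<in> P" for X
    using P(1) that by (auto simp: partition_on_def)
  have part_unique: "X = Y" if "X \<in> P" "Y \<in> P" "u \<in> X" "u \<in> Y" for X Y u
    using P(1) that by (auto simp: partition_on_def disjoint_def)
  have finL: "finite (pverts ?L)"
    using fin by simp
  obtain \<phi> :: "_ \<Rightarrow> nat" where \<phi>: "nonrepetitive_colouring ?L \<phi>"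
    "card (\<phi> ` pverts ?L) = thue_chromatic_number ?L"
    using thue_chromatic_number_attained[OF finL] .
  have in_part: "\<exists>Y\<in>P. x \<in> Y \<times> ?W" if "x \<in> ?V \<times> ?W" for x
    using that P(1) by (auto simp: partition_on_def)
  \<comment> \<open>Over different partite sets the arc comes from \<open>G\<close> alone, whatever
    the coordinates in \<open>H\<close>.\<close>
  have across: "(a, b) \<in> parcs ?L" "a \<in> pverts ?L" "b \<in> pverts ?L" "a \<noteq> b"
    if "X \<in> P" "Y \<in> P" "X \<noteq> Y" "a \<in> X \<times> ?W" "b \<in> Y \<times> ?W" for X Y a b
  proof -
    have "fst a \<in> X" "fst b \<in> Y"
      using that(4,5) by auto
    then have "(fst a, fst b) \<in> parcs G"
      using that(1-3) unfolding arcs by blast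
    then show "(a, b) \<in> parcs ?L" "a \<in> pverts ?L" "b \<in> pverts ?L"
      using that(4,5) part_subset[OF that(1)] part_subset[OF that(2)]
      by (auto simp: lex_product_def)
    show "a \<noteq> b"
      using that(3-5) part_unique[OF that(1,2)] by auto
  qed
  have across_colour: "\<phi> a \<noteq> \<phi> b"
    if "X \<in> P" "Y \<in> P" "X \<noteq> Y" "a \<in> X \<times> ?W" "b \<in> Y \<times> ?W" for X Y a b
    using nonrepetitive_colouring_adjacent[OF \<phi>(1) across[OF that]] .
  have two_parts: "inj_on \<phi> (X \<times> ?W) \<or> inj_on \<phi> (Y \<times> ?W)"
    if XY: "X \<in> P" "Y \<in> P" "X \<noteq> Y" for X Y
  proof (rule ccontr)
    assume "\<not> ?thesis"
    then obtain a a' b b' where ab: "a \<in> X \<times> ?W" "a' \<in> X \<times> ?W" "a \<noteq> a'" "\<phi> a = \<phi> a'"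
      "b \<in> Y \<times> ?W" "b' \<in> Y \<times> ?W" "b \<noteq> b'" "\<phi> b = \<phi> b'"
      unfolding inj_on_def by metis
    \<comment> \<open>The arc from \<open>b\<close> to \<open>a'\<close> runs from \<open>Y\<close>
      back to \<open>X\<close>, hence the swapped roles in \<open>3\<close>; \<open>4\<close>
      supplies \<open>a \<noteq> b'\<close>.\<close>
    note 1 = across[OF XY ab(1,5)] and 2 = across[OF XY ab(2,6)]
      and 3 = across[OF XY(2,1) XY(3)[symmetric] ab(5,2)] and 4 = across[OF XY ab(1,6)]
    have "\<phi> b \<noteq> \<phi> b'"
      using 1 2 3 4 ab by (intro nonrepetitive_colouring_two_pairs[OF \<phi>(1), of a a']) auto
    with ab show False
      by simp
  qed
  \<comment> \<open>\<open>X\<close> is the one partite set whose copies may repeat a colour; if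
    there is none, any member of the non-empty \<open>P\<close> serves.\<close>
  obtain X where X: "X \<in> P" and other: "\<And>Y. Y \<in> P \<Longrightarrow> Y \<noteq> X \<Longrightarrow> inj_on \<phi> (Y \<times> ?W)"
  proof (cases "\<exists>X\<in>P. \<not> inj_on \<phi> (X \<times> ?W)")
    case True
    then show thesis
      using two_parts that by metis
  next
    case False
    then show thesis
      using P(2) that by blast
  qed
  \<comment> \<open>Equal colours force the same partite set by \<open>across_colour\<close>; it
    differs from \<open>X\<close>, so \<open>other\<close> applies.\<close>
  have inj: "inj_on \<phi> ((?V - X) \<times> ?W)"
  proof (rule inj_onI)
    fix x y assume xy: "x \<in> (?V - X) \<times> ?W" "y \<in> (?V - X) \<times> ?W" "\<phi> x = \<phi> y"
    then obtain Y Z where YZ: "Y \<in> P" "Z \<in> P" "x \<in> Y \<times> ?W" "y \<in> Z \<times> ?W"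
      using in_part[of x] in_part[of y] by blast
    then have "Y = Z"
      using across_colour xy(3) by blast
    moreover have "Y \<noteq> X"
      using xy(1) YZ(3) by auto
    ultimately show "x = y"
      using other[of Y] YZ xy(3) by (auto dest: inj_onD)
  qed
  have disj: "\<phi> ` (X \<times> ?W) \<inter> \<phi> ` ((?V - X) \<times> ?W) = {}"
  proof (intro equals0I)
    fix k assume "k \<in> \<phi> ` (X \<times> ?W) \<inter> \<phi> ` ((?V - X) \<times> ?W)"
    then obtain x y where xy: "x \<in> X \<times> ?W" "y \<in> (?V - X) \<times> ?W" "\<phi> x = \<phi> y"
      by (elim IntE imageE) simp
    then obtain Y where Y: "Y \<in> P" "y \<in> Y \<times> ?W"
      using in_part[of y] by blast
    then have "X \<noteq> Y"
      using xy(2) by auto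
    then show False
      using across_colour[OF X Y(1) _ xy(1) Y(2)] xy(3) by blast
  qed
  have "X \<noteq> {}"
    using P(1) X by (auto simp: partition_on_def)
  then obtain u where u: "u \<in> X"
    by blast
  \<comment> \<open>The fibre over a single \<open>u\<close> in \<open>X\<close> is a copy of
    \<open>H\<close>, and its colours are among those over \<open>X\<close>.\<close>
  have "thue_chromatic_number H \<le> card (\<phi> ` Pair u ` ?W)"
  proof (rule thue_chromatic_number_le_embedding[OF fin(2) \<phi>(1)])
    show "(Pair u v, Pair u w) \<in> parcs ?L" if "(v, w) \<in> parcs H" for v w
    proof -
      have "v \<in> ?W" "w \<in> ?W"
        using pair_wf_digraph.wellformed'[OF pair_wf_digraph_pair_graph[OF H] that] .
      then show ?thesis
        using that u X part_subset by (auto simp: lex_product_def)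
    qed
  qed (use u X part_subset in \<open>auto simp: inj_on_def\<close>)
  also have "\<dots> \<le> card (\<phi> ` (X \<times> ?W))"
    using u fin finite_subset[OF part_subset[OF X]] by (intro card_mono) auto
  finally have H_le: "thue_chromatic_number H \<le> card (\<phi> ` (X \<times> ?W))" .
  \<comment> \<open>Independence of \<open>X\<close> gives the right direction: replacing
    \<open>card X\<close> by the larger \<open>independence_number G\<close> can only lower the
    number of vertices counted outside.\<close>
  have "independent_set G X"
    using part_subset[OF X] part_unique[OF X] unfolding independent_set_def arcs by blast
  then have "card X \<le> independence_number G"
    by (rule card_le_independence_number[OF fin(1)])
  then have "(card ?V - independence_number G) * card ?W \<le> (card ?V - card X) * card ?W"
    by (intro mult_right_mono) auto
  also have "\<dots> = card (\<phi> ` ((?V - X) \<times> ?W))"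
    using inj fin part_subset[OF X]
    by (simp add: card_image card_cartesian_product card_Diff_subset finite_subset)
  finally have "thue_chromatic_number H + (card ?V - independence_number G) * card ?W
      \<le> card (\<phi> ` (X \<times> ?W)) + card (\<phi> ` ((?V - X) \<times> ?W))"
    using H_le by linarith
  also have "\<dots> = card (\<phi> ` (X \<times> ?W) \<union> \<phi> ` ((?V - X) \<times> ?W))"
    using disj fin finite_subset[OF part_subset[OF X]] by (intro card_Un_disjoint[symmetric]) auto
  also have "\<phi> ` (X \<times> ?W) \<union> \<phi> ` ((?V - X) \<times> ?W) = \<phi> ` pverts ?L"
    using part_subset[OF X] by auto
  finally show ?thesis
    using \<phi>(2) by simp
qed

section \<open>Exact values\<close>

lemma thue_chromatic_number_lex_product:
  assumes G: "complete_multipartite G" and H: "pair_graph H"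
  shows "thue_chromatic_number (lex_product G H)
    = thue_chromatic_number H + (card (pverts G) - independence_number G) * card (pverts H)"
proof (rule antisym)
  have fin: "finite (pverts G)" "finite (pverts H)"
    using pair_graph_complete_multipartite[OF G] H by (simp_all add: finite_pverts)
  obtain S where "independent_set G S" "card S = independence_number G"
    using independence_number_attained[OF fin(1)] by blast
  then show "thue_chromatic_number (lex_product G H)
    \<le> thue_chromatic_number H + (card (pverts G) - independence_number G) * card (pverts H)"
    using thue_chromatic_number_lex_product_le[OF fin] by metis
qed (rule thue_chromatic_number_lex_product_ge[OF assms])

text \<open>The product of \<open>G\<close> with a one-vertex graph is a copy of \<open>G\<close>.
  Monotonicity along \<open>fst\<close> and along its inverse identifies the two Thue
  numbers.\<close>

lemma thue_chromatic_number_complete_multipartite: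
  assumes G: "complete_multipartite G"
  shows "thue_chromatic_number G = 1 + (card (pverts G) - independence_number G)"
proof -
  define K :: "unit pair_pre_digraph" where "K = \<lparr>pverts = {()}, parcs = {}\<rparr>"
  have K: "pair_graph K"
    by unfold_locales (simp_all add: K_def symmetric_def sym_def)
  have fin: "finite (pverts G)" and wf: "pair_wf_digraph G"
    using pair_graph_complete_multipartite[OF G] finite_pverts pair_wf_digraph_pair_graph
    by blast+
  obtain \<phi> :: "unit \<Rightarrow> nat" where "card (\<phi> ` pverts K) = thue_chromatic_number K"
    using thue_chromatic_number_attained[OF finite_pverts[OF K]] .
  \<comment> \<open>Any colouring of a single vertex uses exactly one colour.\<close>
  then have "thue_chromatic_number K = 1"
    by (simp add: K_def)
  then have "thue_chromatic_number (lex_product G K)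
      = 1 + (card (pverts G) - independence_number G)"
    using thue_chromatic_number_lex_product[OF G K] by (simp add: K_def)
  moreover have "thue_chromatic_number (lex_product G K) \<le> thue_chromatic_number G"
    using fin by (intro thue_chromatic_number_mono[of _ _ fst])
      (auto simp: K_def lex_product_def inj_on_def)
  moreover have "thue_chromatic_number G \<le> thue_chromatic_number (lex_product G K)"
    using fin by (intro thue_chromatic_number_mono[of _ _ "\<lambda>u. (u, ())"])
      (auto simp: K_def lex_product_def inj_on_def
        dest: pair_wf_digraph.in_arcsD1[OF wf] pair_wf_digraph.in_arcsD2[OF wf])
  ultimately show ?thesis
    by simp
qed

theorem theorem2p6:
  fixes G :: "'a pair_pre_digraph" and H :: "'b pair_pre_digraph"
  assumes "complete_multipartite G"
    and "pair_graph H"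
  shows "int (thue_chromatic_number H) + (int (thue_chromatic_number G) - 1) * int (card (pverts H))
           = int (thue_chromatic_number (lex_product G H))
       \<and> int (thue_chromatic_number (lex_product G H))
           = int (thue_chromatic_number H)
             + (int (card (pverts G)) - int (independence_number G)) * int (card (pverts H))"
proof -
  have fin: "finite (pverts G)"
    using assms(1) by (intro finite_pverts pair_graph_complete_multipartite)
  obtain S where "independent_set G S" "card S = independence_number G"
    using independence_number_attained[OF fin] by blast
  \<comment> \<open>This bound makes the truncated difference of natural numbers agree with the
    integer difference in the claim.\<close>
  then have "independence_number G \<le> card (pverts G)"
    using fin by (metis card_mono independent_set_def)
  then show ?thesis
    by (simp add: thue_chromatic_number_lex_product[OF assms]
      thue_chromatic_number_complete_multipartite[OF assms(1)] of_nat_diff)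
qed

end
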